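(* Let $\mathcal{H}$ be a complex Hilbert space and let $A:\mathcal{D}(A)\to\mathcal{H}$ be a densely defined self-adjoint operator. Let $B$ be a self-adjoint operator on $\mathcal{H}$ such that either $B$ is bounded, or $A$ is relatively bounded with respect to $B$. Let $P:=\chi_{\{0\}}(B)$ be the orthogonal projection onto $\ker(B)$. Assume that the compression $\underline{A}$ of $A$ onto $\ker(B)$, i.e. the operator $$\underline{A}=PA:\ \mathcal{D}(A)\cap P\mathcal{H}\longrightarrow P\mathcal{H},$$ is self-adjoint on the Hilbert space $P\mathcal{H}=\ker(B)$. Then for all $z\in\mathbb{C}\setminus\mathbb{R}$ and all $\psi\in\mathcal{H}$, $$\left\|(A+\beta B-z)^{-1}\psi-P(\underline{A}-z)^{-1}P\psi\right\|\longrightarrow 0\quad\text{as }\beta\to\infty .$$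
   Context: Neither $A$ nor $B$ is assumed semi-definite. $A$ is relatively bounded with respect to $B$ means: $\mathcal{D}(B)\subseteq\mathcal{D}(A)$ and there are constants $a,b\ge 0$ (with $a$ not required to be less than $1$) such that $\|A\psi\|\le a\|B\psi\|+b\|\psi\|$ for all $\psi\in\mathcal{D}(B)$. The operator $A+\beta B$ has domain $\mathcal{D}(A)$ if $B$ is bounded, and domain $\mathcal{D}(B)$ in the relatively bounded case, where only sufficiently large real $\beta>0$ are considered, so that $A$ has relative bound less than $1$ with respect to $\beta B$. In $P(\underline{A}-z)^{-1}P$ the resolvent of $\underline{A}$ is taken in the Hilbert space $P\mathcal{H}$, and the outer $P$ is the inclusion $P\mathcal{H}\subseteq\mathcal{H}$. *)

theory Defs
  imports "HOL-Analysis.Analysis"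
begin

text \<open>Complex inner product spaces; the inner product is conjugate-linear in its first argument.
  The last axiom contains positive definiteness, because the norm is already a norm.\<close>

class complex_inner = real_normed_vector +
  fixes scaleC :: "complex \<Rightarrow> 'a \<Rightarrow> 'a"  (infixr "*\<^sub>C" 75)
    and cinner :: "'a \<Rightarrow> 'a \<Rightarrow> complex"
  assumes scaleC_add_right: "c *\<^sub>C (x + y) = c *\<^sub>C x + c *\<^sub>C y"
    and scaleC_add_left: "(c + d) *\<^sub>C x = c *\<^sub>C x + d *\<^sub>C x"
    and scaleC_scaleC: "c *\<^sub>C d *\<^sub>C x = (c * d) *\<^sub>C x"
    and scaleC_of_real: "complex_of_real r *\<^sub>C x = r *\<^sub>R x"
    and cinner_commute: "cinner x y = cnj (cinner y x)"
    and cinner_add_right: "cinner x (y + z) = cinner x y + cinner x z"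
    and cinner_scaleC_right: "cinner x (c *\<^sub>C y) = c * cinner x y"
    and cinner_self: "cinner x x = complex_of_real ((norm x)\<^sup>2)"

class complex_hilbert = complex_inner + complete_space

instantiation complex :: complex_hilbert
begin

definition scaleC_complex :: "complex \<Rightarrow> complex \<Rightarrow> complex"
  where "scaleC_complex c x = c * x"

definition cinner_complex :: "complex \<Rightarrow> complex \<Rightarrow> complex"
  where "cinner_complex x y = cnj x * y"

instance
proof
  fix x :: complex
  show "cinner x x = complex_of_real ((norm x)\<^sup>2)"
    by (metis cinner_complex_def complex_norm_square mult.commute of_real_power)
qed (auto simp: scaleC_complex_def cinner_complex_def algebra_simps scaleR_conv_of_real)

end

definition csubspace :: "'h::complex_inner set \<Rightarrow> bool"
  where "csubspace S \<longleftrightarrow>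
    0 \<in> S \<and> (\<forall>x\<in>S. \<forall>y\<in>S. x + y \<in> S) \<and> (\<forall>c. \<forall>x\<in>S. c *\<^sub>C x \<in> S)"

text \<open>A partially defined operator is a domain together with a total function whose values
  outside the domain carry no meaning.  Hence operators are compared with \<open>op_eq\<close>, not with
  HOL equality.\<close>

datatype 'h partial_op = Op (op_dom: "'h set") (op_app: "'h \<Rightarrow> 'h")

definition op_eq :: "'h partial_op \<Rightarrow> 'h partial_op \<Rightarrow> bool"
  where "op_eq S T \<longleftrightarrow> op_dom S = op_dom T \<and> (\<forall>x\<in>op_dom T. op_app S x = op_app T x)"

text \<open>In the following, the argument \<open>K\<close> is a closed subspace of the ambient type, regarded as a
  Hilbert space in its own right.\<close>

definition linear_operator_on :: "'h::complex_inner set \<Rightarrow> 'h partial_op \<Rightarrow> bool"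
  where "linear_operator_on K T \<longleftrightarrow>
    csubspace (op_dom T) \<and> op_dom T \<subseteq> K \<and> op_app T ` op_dom T \<subseteq> K \<and>
    (\<forall>x\<in>op_dom T. \<forall>y\<in>op_dom T. op_app T (x + y) = op_app T x + op_app T y) \<and>
    (\<forall>c. \<forall>x\<in>op_dom T. op_app T (c *\<^sub>C x) = c *\<^sub>C op_app T x)"

definition densely_defined_on :: "'h::complex_inner set \<Rightarrow> 'h partial_op \<Rightarrow> bool"
  where "densely_defined_on K T \<longleftrightarrow> K \<subseteq> closure (op_dom T)"

definition adjoint_on :: "'h::complex_inner set \<Rightarrow> 'h partial_op \<Rightarrow> 'h partial_op"
  where "adjoint_on K T =
    Op {y \<in> K. \<exists>w\<in>K. \<forall>x\<in>op_dom T. cinner y (op_app T x) = cinner w x}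
       (\<lambda>y. THE w. w \<in> K \<and> (\<forall>x\<in>op_dom T. cinner y (op_app T x) = cinner w x))"

definition self_adjoint_on :: "'h::complex_inner set \<Rightarrow> 'h partial_op \<Rightarrow> bool"
  where "self_adjoint_on K T \<longleftrightarrow>
    linear_operator_on K T \<and> densely_defined_on K T \<and> op_eq (adjoint_on K T) T"

definition bounded_op :: "'h::complex_inner partial_op \<Rightarrow> bool"
  where "bounded_op T \<longleftrightarrow> (\<exists>M. \<forall>x\<in>op_dom T. norm (op_app T x) \<le> M * norm x)"

definition relatively_bounded :: "'h::complex_inner partial_op \<Rightarrow> 'h partial_op \<Rightarrow> bool"
  where "relatively_bounded A B \<longleftrightarrow> op_dom B \<subseteq> op_dom A \<and>
    (\<exists>a\<ge>0. \<exists>b\<ge>0. \<forall>x\<in>op_dom B. norm (op_app A x) \<le> a * norm (op_app B x) + b * norm x)"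

definition op_kernel :: "'h::complex_inner partial_op \<Rightarrow> 'h set"
  where "op_kernel T = {x \<in> op_dom T. op_app T x = 0}"

definition ortho_proj :: "'h::complex_inner set \<Rightarrow> 'h \<Rightarrow> 'h"
  where "ortho_proj K x = (THE y. y \<in> K \<and> (\<forall>w\<in>K. cinner w (x - y) = 0))"

definition compression :: "'h::complex_inner set \<Rightarrow> 'h partial_op \<Rightarrow> 'h partial_op"
  where "compression K T = Op (op_dom T \<inter> K) (\<lambda>x. ortho_proj K (op_app T x))"

text \<open>The natural domain of \<open>A + \<beta> B\<close> is the intersection of both domains.  This is the domain
  of \<open>A\<close> if \<open>B\<close> is self-adjoint and bounded (then \<open>B\<close> is everywhere defined), and the
  domain of \<open>B\<close> if \<open>A\<close> is relatively bounded with respect to \<open>B\<close>.\<close>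

definition op_plus :: "'h::complex_inner partial_op \<Rightarrow> 'h partial_op \<Rightarrow> 'h partial_op"
  where "op_plus S T = Op (op_dom S \<inter> op_dom T) (\<lambda>x. op_app S x + op_app T x)"

definition op_scale :: "complex \<Rightarrow> 'h::complex_inner partial_op \<Rightarrow> 'h partial_op"
  where "op_scale c T = Op (op_dom T) (\<lambda>x. c *\<^sub>C op_app T x)"

definition op_shift :: "'h::complex_inner partial_op \<Rightarrow> complex \<Rightarrow> 'h partial_op"
  where "op_shift T z = Op (op_dom T) (\<lambda>x. op_app T x - z *\<^sub>C x)"

definition op_inverse :: "'h partial_op \<Rightarrow> 'h partial_op"
  where "op_inverse T = Op (op_app T ` op_dom T) (\<lambda>y. THE x. x \<in> op_dom T \<and> op_app T x = y)"

text \<open>The operator \<open>(T - z)\<^sup>-\<^sup>1\<close>.  For an operator in a subspace \<open>K\<close> its domain and range lie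
  in \<open>K\<close>, so this is the resolvent in the Hilbert space \<open>K\<close>.\<close>

definition resolvent :: "'h::complex_inner partial_op \<Rightarrow> complex \<Rightarrow> 'h partial_op"
  where "resolvent T z = op_inverse (op_shift T z)"

end

theory Submission imports Defs begin

text \<open>
  Write \<open>R\<^sub>\<beta> = (A + \<beta> B - z)\<^sup>-\<^sup>1\<close> and \<open>\<phi> = (PA - z)\<^sup>-\<^sup>1 P \<psi>\<close>, a vector in \<open>ker B\<close>.  Since
  \<open>A + \<beta> B\<close> is symmetric, a trial vector \<open>v\<close> satisfies
  \<open>\<parallel>R\<^sub>\<beta> \<psi> - v\<parallel> \<le> \<parallel>\<psi> - (A + \<beta> B - z) v\<parallel> / \<bar>Im z\<bar>\<close> (\<open>resolvent_residual_estimate\<close>), so it is enough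
  to find \<open>v\<close> close to \<open>\<phi>\<close> that nearly solves the equation.  The choice \<open>v = \<phi>\<close> leaves the
  residual \<open>g = \<psi> - (A - z) \<phi>\<close>, which is independent of \<open>\<beta>\<close>
  because \<open>B \<phi> = 0\<close>, and satisfies \<open>P g = 0\<close>.  As
  \<open>g\<close> is orthogonal to \<open>ker B\<close>, it is a limit of vectors \<open>B \<eta>\<close> with \<open>\<eta>\<close> in the domain of both
  operators (\<open>orthogonal_op_kernel_imp_closure_image\<close>, \<open>coupling_domain_core\<close>).  The first-order
  correction \<open>v = \<phi> + \<eta> / \<beta>\<close> has the residual \<open>(g - B \<eta>) - (A - z) \<eta> / \<beta>\<close>.  Therefore
  \<open>\<parallel>R\<^sub>\<beta> \<psi> - \<phi>\<parallel> \<le> \<parallel>g - B \<eta>\<parallel> / \<bar>Im z\<bar> + C\<^sub>\<eta> / \<beta>\<close>,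
  where \<open>\<eta>\<close> makes the first term small and then \<open>\<beta>\<close> the second.

  This uses that the resolvents exist on the whole space.  For a self-adjoint operator \<open>T\<close> the range
  of \<open>T - z\<close> is closed and has no orthogonal complement (\<open>self_adjoint_shift_surj\<close>, based on
  \<open>orthogonal_projection_exists\<close>), and \<open>A + \<beta> B\<close> is self-adjoint for large \<open>\<beta>\<close> by the
  \<open>Kato_Rellich\<close> theorem, in which either \<open>\<beta> B\<close> or \<open>A\<close> is the perturbation
  (\<open>self_adjoint_coupling\<close>).
\<close>

section \<open>Complex inner products\<close>

lemma cinner_add_left: "cinner (x + y) z = cinner x z + cinner (y::'h::complex_inner) z"
  by (metis cinner_commute cinner_add_right complex_cnj_add)

lemma cinner_scaleC_left: "cinner (c *\<^sub>C x) y = cnj c * cinner (x::'h::complex_inner) y"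
  by (metis cinner_commute cinner_scaleC_right complex_cnj_mult)

lemma scaleC_minus_one: "(- 1) *\<^sub>C x = - (x::'h::complex_inner)"
  using scaleC_of_real[of "-1" x] by simp

lemma cinner_minus_right: "cinner x (- y) = - cinner x (y::'h::complex_inner)"
  by (metis cinner_scaleC_right mult_minus1 scaleC_minus_one)

lemma cinner_minus_left: "cinner (- x) y = - cinner x (y::'h::complex_inner)"
  by (metis cinner_commute cinner_minus_right complex_cnj_minus)

lemma cinner_diff_right: "cinner x (y - z) = cinner x y - cinner x (z::'h::complex_inner)"
  by (metis cinner_add_right cinner_minus_right diff_conv_add_uminus)

lemma cinner_diff_left: "cinner (x - y) z = cinner x z - cinner (y::'h::complex_inner) z"
  by (metis cinner_add_left cinner_minus_left diff_conv_add_uminus)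

lemma cinner_zero_right [simp]: "cinner x (0::'h::complex_inner) = 0"
  by (metis cinner_diff_right diff_self)

lemma cinner_zero_left [simp]: "cinner 0 (x::'h::complex_inner) = 0"
  by (metis cinner_diff_left diff_self)

lemma cinner_scaleR_right: "cinner x (r *\<^sub>R y) = of_real r * cinner x (y::'h::complex_inner)"
  by (metis cinner_scaleC_right scaleC_of_real)

lemma cinner_self_eq_0: "cinner x x = 0 \<longleftrightarrow> x = (0::'h::complex_inner)"
  by (simp add: cinner_self)

lemma scaleC_zero_right [simp]: "c *\<^sub>C 0 = (0::'h::complex_inner)"
  by (metis add_cancel_right_left scaleC_add_right)

lemma scaleC_minus_right: "c *\<^sub>C (- x) = - (c *\<^sub>C (x::'h::complex_inner))"
  by (metis add_eq_0_iff scaleC_add_right scaleC_zero_right)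

lemma scaleC_diff_right: "c *\<^sub>C (x - y) = c *\<^sub>C x - c *\<^sub>C (y::'h::complex_inner)"
  by (metis diff_conv_add_uminus scaleC_add_right scaleC_minus_right)

lemma scaleC_diff_left: "(c - d) *\<^sub>C x = c *\<^sub>C x - d *\<^sub>C (x::'h::complex_inner)"
  by (metis add_diff_cancel_right' diff_add_cancel scaleC_add_left)

lemma norm_scaleC: "norm (c *\<^sub>C x) = cmod c * norm (x::'h::complex_inner)"
proof -
  have "complex_of_real ((norm (c *\<^sub>C x))\<^sup>2) = (cnj c * c) * complex_of_real ((norm x)\<^sup>2)"
    by (simp only: cinner_self[symmetric] cinner_scaleC_left cinner_scaleC_right mult.assoc)
       (simp add: mult.left_commute)
  also have "\<dots> = complex_of_real ((cmod c * norm x)\<^sup>2)"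
    by (metis complex_norm_square mult.commute of_real_mult power_mult_distrib)
  finally show ?thesis
    by (simp only: of_real_eq_iff) (simp add: power2_eq_iff_nonneg)
qed

lemma norm_add_square:
  "(norm (x + y))\<^sup>2 = (norm x)\<^sup>2 + (norm y)\<^sup>2 + 2 * Re (cinner x (y::'h::complex_inner))"
proof -
  have "complex_of_real ((norm (x + y))\<^sup>2) = cinner x x + cinner y y + (cinner x y + cnj (cinner x y))"
    by (simp only: cinner_self[symmetric] cinner_add_left cinner_add_right cinner_commute[of y x])
       (simp add: cinner_commute[of y x])
  also have "\<dots> = complex_of_real ((norm x)\<^sup>2 + (norm y)\<^sup>2 + 2 * Re (cinner x y))"
    by (simp add: cinner_self complex_add_cnj)
  finally show ?thesis by (simp only: of_real_eq_iff)
qed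

lemma parallelogram_law:
  "(norm (x + y))\<^sup>2 + (norm (x - y))\<^sup>2 = 2 * (norm x)\<^sup>2 + 2 * (norm (y::'h::complex_inner))\<^sup>2"
  using norm_add_square[of x y] norm_add_square[of x "- y"] by (simp add: cinner_minus_right)

text \<open>Removing from \<open>u\<close> its component along \<open>w\<close>.  Nonnegativity of the left-hand side is the
  Cauchy--Schwarz inequality, and the strict decrease of the norm is what makes a nearest point of a
  subspace an orthogonal projection.\<close>

lemma norm_remove_component:
  fixes u w :: "'h::complex_inner"
  assumes "w \<noteq> 0"
  shows "(norm (u - (cinner w u / of_real ((norm w)\<^sup>2)) *\<^sub>C w))\<^sup>2
    = (norm u)\<^sup>2 - (cmod (cinner w u))\<^sup>2 / (norm w)\<^sup>2"
proof -
  define c where "c = cinner w u / of_real ((norm w)\<^sup>2)"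
  have cross: "c * cinner u w = of_real ((cmod (cinner w u))\<^sup>2 / (norm w)\<^sup>2)"
    by (simp only: of_real_divide complex_norm_square c_def cinner_commute[of u w]) simp
  have "cmod c = cmod (cinner w u) / (norm w)\<^sup>2"
    by (simp add: c_def norm_divide norm_power)
  then have "(cmod c * norm w)\<^sup>2 = (cmod (cinner w u))\<^sup>2 / (norm w)\<^sup>2"
    using assms by (simp add: field_simps power2_eq_square)
  then have "(norm (u - c *\<^sub>C w))\<^sup>2 = (norm u)\<^sup>2 - (cmod (cinner w u))\<^sup>2 / (norm w)\<^sup>2"
    using norm_add_square[of u "- (c *\<^sub>C w)"] cross
    by (simp add: cinner_minus_right cinner_scaleC_right norm_scaleC)
  then show ?thesis by (simp only: c_def)
qed

lemma cinner_Cauchy_Schwarz: "cmod (cinner x y) \<le> norm x * norm (y::'h::complex_inner)"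
proof (cases "x = 0")
  case False
  have "0 \<le> (norm y)\<^sup>2 - (cmod (cinner x y))\<^sup>2 / (norm x)\<^sup>2"
    by (metis norm_remove_component[OF False] zero_le_power2)
  then have "(cmod (cinner x y))\<^sup>2 \<le> (norm x * norm y)\<^sup>2"
    using False by (simp add: field_simps)
  then show ?thesis by (simp add: power2_le_iff_abs_le)
qed simp

lemma bounded_linear_cinner_right: "bounded_linear (cinner (x::'h::complex_inner))"
  by (rule bounded_linear_intro[where K = "norm x"])
     (simp_all add: cinner_add_right cinner_scaleR_right scaleR_conv_of_real
       cinner_Cauchy_Schwarz mult.commute[of _ "norm x"])

lemmas tendsto_cinner_right = bounded_linear.tendsto[OF bounded_linear_cinner_right]

lemma tendsto_cinner_left:
  assumes "(f \<longlongrightarrow> l) F"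
  shows "((\<lambda>n. cinner (f n) (y::'h::complex_inner)) \<longlongrightarrow> cinner l y) F"
  using tendsto_cnj[OF tendsto_cinner_right[OF assms, of y]] by (simp add: cinner_commute[of _ y])

lemma orthogonal_to_closure:
  fixes w :: "'h::complex_inner"
  assumes "\<And>x. x \<in> S \<Longrightarrow> cinner w x = 0" and "x \<in> closure S"
  shows "cinner w x = 0"
proof -
  obtain s where s: "\<And>n. s n \<in> S" "s \<longlonglongrightarrow> x"
    using assms(2) closure_sequential by blast
  then have "(\<lambda>n. cinner w (s n)) \<longlonglongrightarrow> cinner w x"
    by (intro tendsto_cinner_right)
  moreover have "(\<lambda>n. cinner w (s n)) = (\<lambda>n. 0)"
    using assms(1) s(1) by simp
  ultimately show ?thesis
    by (simp add: LIMSEQ_const_iff)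
qed

section \<open>Orthogonal projection onto a closed subspace\<close>

lemma csubspace_diff:
  assumes "csubspace S" "x \<in> S" "y \<in> S"
  shows "x - y \<in> (S::'h::complex_inner set)"
  using assms scaleC_minus_one[of y] unfolding csubspace_def by (metis diff_conv_add_uminus)

lemma csubspace_scaleR:
  assumes "csubspace S" "x \<in> S"
  shows "r *\<^sub>R x \<in> (S::'h::complex_inner set)"
  using assms scaleC_of_real[of r x] unfolding csubspace_def by metis

lemma csubspace_UNIV: "csubspace UNIV"
  by (simp add: csubspace_def)

lemma bounded_linear_scaleC: "bounded_linear (\<lambda>x. c *\<^sub>C (x::'h::complex_inner))"
  by (rule bounded_linear_intro[where K = "cmod c"])
     (simp_all add: scaleC_add_right norm_scaleC scaleC_of_real[symmetric] scaleC_scaleC mult.commute)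

lemmas tendsto_scaleC = bounded_linear.tendsto[OF bounded_linear_scaleC]

lemma csubspace_closure:
  assumes "csubspace (S::'h::complex_inner set)"
  shows "csubspace (closure S)"
  unfolding csubspace_def
proof (intro conjI ballI allI)
  show "0 \<in> closure S"
    using assms closure_subset unfolding csubspace_def by blast
next
  fix x y assume "x \<in> closure S" "y \<in> closure S"
  then obtain s t where "\<And>n. s n \<in> S" "s \<longlonglongrightarrow> x" "\<And>n. t n \<in> S" "t \<longlonglongrightarrow> y"
    unfolding closure_sequential by blast
  then have "\<And>n. s n + t n \<in> S" "(\<lambda>n. s n + t n) \<longlonglongrightarrow> x + y"
    using assms by (auto simp: csubspace_def intro: tendsto_add)
  then show "x + y \<in> closure S"
    unfolding closure_sequential by (intro exI[of _ "\<lambda>n. s n + t n"]) simp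
next
  fix c x assume "x \<in> closure S"
  then obtain s where "\<And>n. s n \<in> S" "s \<longlonglongrightarrow> x"
    unfolding closure_sequential by blast
  then have "\<And>n. c *\<^sub>C s n \<in> S" "(\<lambda>n. c *\<^sub>C s n) \<longlonglongrightarrow> c *\<^sub>C x"
    using assms by (auto simp: csubspace_def intro: tendsto_scaleC)
  then show "c *\<^sub>C x \<in> closure S"
    unfolding closure_sequential by (intro exI[of _ "\<lambda>n. c *\<^sub>C s n"]) simp
qed

text \<open>A sequence of points of the subspace whose distances to \<open>x\<close> tend to the infimum is Cauchy by
  the parallelogram law, since midpoints cannot be nearer than the infimum.  Its limit is a nearest
  point \<open>y\<close>, and \<open>x - y\<close> is orthogonal to the subspace because removing a component along it would
  bring it closer.\<close>

theorem orthogonal_projection_exists: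
  fixes K :: "'h::complex_hilbert set"
  assumes K: "closed K" "csubspace K"
  obtains y where "y \<in> K" "\<And>w. w \<in> K \<Longrightarrow> cinner w (x - y) = 0"
proof -
  define d where "d = infdist x K"
  have ne: "K \<noteq> {}" using K(2) by (auto simp: csubspace_def)
  have d0: "0 \<le> d" by (simp add: d_def infdist_nonneg)
  have dle: "d\<^sup>2 \<le> (norm (x - w))\<^sup>2" if "w \<in> K" for w
    using infdist_le[OF that, of x] d0 by (intro power_mono) (simp_all add: d_def dist_norm)
  have "\<exists>w\<in>K. (norm (x - w))\<^sup>2 < d\<^sup>2 + 1 / Suc n" for n
  proof -
    have "d < sqrt (d\<^sup>2 + 1 / Suc n)"
      using d0 by (intro real_less_rsqrt) simp
    then obtain w where "w \<in> K" "dist x w < sqrt (d\<^sup>2 + 1 / Suc n)"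
      using ne cINF_less_iff[of K "dist x" "sqrt (d\<^sup>2 + 1 / Suc n)"]
      by (auto simp: d_def infdist_def)
    then have "(norm (x - w))\<^sup>2 < (sqrt (d\<^sup>2 + 1 / Suc n))\<^sup>2"
      by (intro power_strict_mono) (simp_all add: dist_norm)
    with \<open>w \<in> K\<close> show ?thesis by (intro bexI[of _ w]) simp_all
  qed
  then obtain s where sK: "\<And>n. s n \<in> K" and s: "\<And>n. (norm (x - s n))\<^sup>2 < d\<^sup>2 + 1 / Suc n"
    by metis
  have close: "(norm (s m - s n))\<^sup>2 < 2 / Suc m + 2 / Suc n" for m n
  proof -
    have "(1/2) *\<^sub>R (s m + s n) \<in> K"
      using K(2) sK by (intro csubspace_scaleR) (auto simp: csubspace_def)
    then have "4 * d\<^sup>2 \<le> 4 * (norm (x - (1/2) *\<^sub>R (s m + s n)))\<^sup>2"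
      using dle by simp
    also have "\<dots> = (norm (2 *\<^sub>R (x - (1/2) *\<^sub>R (s m + s n))))\<^sup>2"
      by (simp add: power_mult_distrib)
    also have "2 *\<^sub>R (x - (1/2) *\<^sub>R (s m + s n)) = (x - s n) + (x - s m)"
      by (simp add: algebra_simps scaleR_2)
    finally show ?thesis
      using parallelogram_law[of "x - s n" "x - s m"] s[of m] s[of n]
      by (simp add: algebra_simps)
  qed
  have "Cauchy s"
  proof (rule metric_CauchyI)
    fix e :: real assume "0 < e"
    then obtain N where N: "1 / Suc N < e\<^sup>2 / 4"
      using reals_Archimedean[of "e\<^sup>2 / 4"] by (auto simp: inverse_eq_divide)
    show "\<exists>M. \<forall>m\<ge>M. \<forall>n\<ge>M. dist (s m) (s n) < e"
    proof (intro exI allI impI)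
      fix m n assume "N \<le> m" "N \<le> n"
      then have "1 / Suc m \<le> 1 / Suc N" "1 / Suc n \<le> 1 / Suc N"
        by (simp_all add: frac_le)
      then have "(norm (s m - s n))\<^sup>2 < e\<^sup>2"
        using close[of m n] N by simp
      then show "dist (s m) (s n) < e"
        using \<open>0 < e\<close> by (simp add: dist_norm power2_less_imp_less)
    qed
  qed
  then obtain y where y: "s \<longlonglongrightarrow> y"
    using Cauchy_convergent_iff convergent_def by blast
  have yK: "y \<in> K"
    using closed_sequentially[OF K(1) _ y] sK by blast
  have "(norm (x - y))\<^sup>2 \<le> d\<^sup>2"
  proof (rule LIMSEQ_le)
    show "(\<lambda>n. (norm (x - s n))\<^sup>2) \<longlonglongrightarrow> (norm (x - y))\<^sup>2"
      by (intro tendsto_intros y)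
    show "(\<lambda>n. d\<^sup>2 + 1 / Suc n) \<longlonglongrightarrow> d\<^sup>2"
      using LIMSEQ_inverse_real_of_nat_add[of "d\<^sup>2"] by (simp add: inverse_eq_divide)
  qed (use s less_imp_le in blast)
  then have min: "(norm (x - y))\<^sup>2 \<le> (norm (x - w))\<^sup>2" if "w \<in> K" for w
    using dle[OF that] by (rule order_trans)
  have "cinner w (x - y) = 0" if "w \<in> K" for w
  proof (cases "w = 0")
    case False
    define c where "c = cinner w (x - y) / of_real ((norm w)\<^sup>2)"
    have "y + c *\<^sub>C w \<in> K"
      using K(2) yK that by (auto simp: csubspace_def)
    then have "(norm (x - y))\<^sup>2 \<le> (norm (x - y - c *\<^sub>C w))\<^sup>2"
      using min by (metis diff_diff_eq)
    then have "(cmod (cinner w (x - y)))\<^sup>2 / (norm w)\<^sup>2 \<le> 0"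
      using norm_remove_component[OF False, of "x - y"] by (simp only: c_def) 
    then show ?thesis
      using False by (simp add: divide_le_0_iff)
  qed simp
  with yK show ?thesis using that by blast
qed

lemma
  fixes K :: "'h::complex_hilbert set"
  assumes K: "closed K" "csubspace K"
  shows ortho_proj_in: "ortho_proj K x \<in> K"
    and ortho_proj_orthogonal: "w \<in> K \<Longrightarrow> cinner w (x - ortho_proj K x) = 0"
proof -
  obtain y where y: "y \<in> K" "\<And>w. w \<in> K \<Longrightarrow> cinner w (x - y) = 0"
    using orthogonal_projection_exists[OF K] by blast
  have "ortho_proj K x = y"
    unfolding ortho_proj_def
  proof (rule the_equality)
    fix v assume v: "v \<in> K \<and> (\<forall>w\<in>K. cinner w (x - v) = 0)"
    then have "v - y \<in> K" using y(1) K(2) csubspace_diff by blast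
    then have "cinner (v - y) ((x - y) - (x - v)) = 0"
      using v y(2) by (simp only: cinner_diff_right) simp
    then show "v = y" by (simp add: cinner_self_eq_0)
  qed (use y in auto)
  with y show "ortho_proj K x \<in> K" "w \<in> K \<Longrightarrow> cinner w (x - ortho_proj K x) = 0"
    by auto
qed

lemma closed_subspace_eqI:
  fixes V K :: "'h::complex_hilbert set"
  assumes V: "closed V" "csubspace V" and K: "csubspace K" and "V \<subseteq> K"
    and orth: "\<And>w. w \<in> K \<Longrightarrow> (\<And>v. v \<in> V \<Longrightarrow> cinner w v = 0) \<Longrightarrow> w = 0"
  shows "V = K"
proof
  show "K \<subseteq> V"
  proof
    fix x assume "x \<in> K"
    obtain y where y: "y \<in> V" "\<And>v. v \<in> V \<Longrightarrow> cinner v (x - y) = 0"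
      using orthogonal_projection_exists[OF V] by blast
    have "x - y = 0"
    proof (rule orth)
      show "x - y \<in> K" using K \<open>x \<in> K\<close> y(1) \<open>V \<subseteq> K\<close> csubspace_diff by blast
      show "cinner (x - y) v = 0" if "v \<in> V" for v
        using y(2)[OF that] by (subst cinner_commute) simp
    qed
    with y(1) show "x \<in> V" by simp
  qed
qed fact

section \<open>Symmetric and self-adjoint operators\<close>

lemma linear_operator_onD:
  assumes "linear_operator_on K T"
  shows "csubspace (op_dom T)" "op_dom T \<subseteq> K"
    and "x \<in> op_dom T \<Longrightarrow> op_app T x \<in> K"
    and "x \<in> op_dom T \<Longrightarrow> y \<in> op_dom T \<Longrightarrow> op_app T (x + y) = op_app T x + op_app T y"
    and "x \<in> op_dom T \<Longrightarrow> op_app T (c *\<^sub>C x) = c *\<^sub>C op_app T x"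
    and "x \<in> op_dom T \<Longrightarrow> op_app T (r *\<^sub>R x) = r *\<^sub>R op_app T x"
    and "x \<in> op_dom T \<Longrightarrow> y \<in> op_dom T \<Longrightarrow> op_app T (x - y) = op_app T x - op_app T y"
proof -
  show D: "csubspace (op_dom T)" and "op_dom T \<subseteq> K"
    and "x \<in> op_dom T \<Longrightarrow> op_app T x \<in> K"
    and add: "\<And>x y. x \<in> op_dom T \<Longrightarrow> y \<in> op_dom T \<Longrightarrow> op_app T (x + y) = op_app T x + op_app T y"
    and sc: "\<And>c x. x \<in> op_dom T \<Longrightarrow> op_app T (c *\<^sub>C x) = c *\<^sub>C op_app T x"
    using assms unfolding linear_operator_on_def by auto
  show "x \<in> op_dom T \<Longrightarrow> op_app T (r *\<^sub>R x) = r *\<^sub>R op_app T x"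
    using sc[of x "of_real r"] by (simp add: scaleC_of_real)
  show "op_app T (x - y) = op_app T x - op_app T y" if "x \<in> op_dom T" "y \<in> op_dom T"
    using add[of "x - y" y] csubspace_diff[OF D] that by (simp add: algebra_simps)
qed

lemma shifted_op_diff:
  assumes "linear_operator_on K T" "x \<in> op_dom T" "y \<in> op_dom T"
  shows "op_app T (x - y) - z *\<^sub>C (x - y)
    = (op_app T x - z *\<^sub>C x) - (op_app T y - z *\<^sub>C y)"
  by (simp add: linear_operator_onD(7)[OF assms] scaleC_diff_right)

definition symmetric_op :: "'h::complex_inner partial_op \<Rightarrow> bool"
  where "symmetric_op T \<longleftrightarrow>
    (\<forall>x\<in>op_dom T. \<forall>y\<in>op_dom T. cinner y (op_app T x) = cinner (op_app T y) x)"

lemma adjoint_value_unique: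
  fixes K :: "'h::complex_inner set"
  assumes "csubspace K" "densely_defined_on K T" "v \<in> K" "w \<in> K"
    and "\<And>x. x \<in> op_dom T \<Longrightarrow> cinner v x = cinner w x"
  shows "v = w"
proof -
  have "v - w \<in> closure (op_dom T)"
    using assms csubspace_diff unfolding densely_defined_on_def by blast
  then have "cinner (v - w) (v - w) = 0"
    by (rule orthogonal_to_closure[rotated]) (simp add: cinner_diff_left assms(5))
  then show ?thesis by (simp add: cinner_self_eq_0)
qed

text \<open>Self-adjointness enters the later proofs in this form: a symmetry, and a maximality that puts
  \<open>y\<close> into the domain once it satisfies the weak equation \<open>T y = w\<close>.  Density of the domain makes
  the description of the adjoint's values unique.\<close>

lemma
  fixes K :: "'h::complex_inner set"
  assumes T: "self_adjoint_on K T" and K: "csubspace K"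
  shows self_adjoint_symmetric: "symmetric_op T"
    and self_adjoint_maximal:
      "\<lbrakk>y \<in> K; w \<in> K; \<And>x. x \<in> op_dom T \<Longrightarrow> cinner y (op_app T x) = cinner w x\<rbrakk>
        \<Longrightarrow> y \<in> op_dom T \<and> op_app T y = w"
proof -
  have dense: "densely_defined_on K T"
    and dom: "op_dom (adjoint_on K T) = op_dom T"
    and app: "\<And>y. y \<in> op_dom T \<Longrightarrow> op_app (adjoint_on K T) y = op_app T y"
    using T by (auto simp: self_adjoint_on_def op_eq_def)
  have val: "op_app T y = w"
    if "y \<in> op_dom T" "w \<in> K" "\<And>x. x \<in> op_dom T \<Longrightarrow> cinner y (op_app T x) = cinner w x" for y w
  proof -
    have "op_app (adjoint_on K T) y = w"
      unfolding adjoint_on_def partial_op.sel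
      by (rule the_equality) (use that adjoint_value_unique[OF K dense] in auto)
    then show ?thesis using app[OF that(1)] by simp
  qed
  show "symmetric_op T"
    unfolding symmetric_op_def
  proof (intro ballI)
    fix x y assume x: "x \<in> op_dom T" and y: "y \<in> op_dom T"
    then obtain w where "w \<in> K" "\<forall>x\<in>op_dom T. cinner y (op_app T x) = cinner w x"
      using dom by (auto simp: adjoint_on_def)
    with val[OF y] x show "cinner y (op_app T x) = cinner (op_app T y) x" by simp
  qed
  assume "y \<in> K" "w \<in> K" and yw: "\<And>x. x \<in> op_dom T \<Longrightarrow> cinner y (op_app T x) = cinner w x"
  then have "y \<in> op_dom (adjoint_on K T)" by (auto simp: adjoint_on_def)
  with dom have "y \<in> op_dom T" by simp
  with val[OF this \<open>w \<in> K\<close> yw] show "y \<in> op_dom T \<and> op_app T y = w" by simp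
qed

lemma self_adjoint_onI:
  fixes K :: "'h::complex_inner set"
  assumes K: "csubspace K" and T: "linear_operator_on K T" "densely_defined_on K T" "symmetric_op T"
    and max: "\<And>y w. \<lbrakk>y \<in> K; w \<in> K; \<And>x. x \<in> op_dom T \<Longrightarrow> cinner y (op_app T x) = cinner w x\<rbrakk>
      \<Longrightarrow> y \<in> op_dom T"
  shows "self_adjoint_on K T"
proof -
  have sym: "y \<in> K" "op_app T y \<in> K"
    "\<And>x. x \<in> op_dom T \<Longrightarrow> cinner y (op_app T x) = cinner (op_app T y) x" if "y \<in> op_dom T" for y
    using that T(3) linear_operator_onD(2,3)[OF T(1)] by (auto simp: symmetric_op_def)
  have "op_dom (adjoint_on K T) = op_dom T"
  proof (intro set_eqI iffI)
    fix y assume "y \<in> op_dom T"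
    then show "y \<in> op_dom (adjoint_on K T)"
      unfolding adjoint_on_def partial_op.sel using sym by blast
  next
    fix y assume "y \<in> op_dom (adjoint_on K T)"
    then obtain w where "y \<in> K" "w \<in> K" "\<forall>x\<in>op_dom T. cinner y (op_app T x) = cinner w x"
      by (auto simp: adjoint_on_def)
    then show "y \<in> op_dom T" using max by blast
  qed
  moreover have "op_app (adjoint_on K T) y = op_app T y" if "y \<in> op_dom T" for y
    unfolding adjoint_on_def partial_op.sel
    by (rule the_equality) (use sym[OF that] adjoint_value_unique[OF K T(2)] in auto)
  ultimately show ?thesis
    using T by (simp add: self_adjoint_on_def op_eq_def)
qed

text \<open>The quadratic form of a symmetric operator is real, so the parts of \<open>T - z\<close> coming from
  \<open>T - Re z\<close> and from \<open>Im z\<close> are orthogonal in the real sense.\<close>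

lemma norm_op_shift_square:
  fixes T :: "'h::complex_inner partial_op"
  assumes "symmetric_op T" "x \<in> op_dom T"
  shows "(norm (op_app T x - z *\<^sub>C x))\<^sup>2
    = (norm (op_app T x - Re z *\<^sub>R x))\<^sup>2 + (\<bar>Im z\<bar> * norm x)\<^sup>2"
proof -
  define u where "u = op_app T x - Re z *\<^sub>R x"
  define c where "c = - (\<i> * of_real (Im z))"
  have "cinner x (op_app T x) = cnj (cinner x (op_app T x))"
    using assms by (metis symmetric_op_def cinner_commute)
  then have "Im (cinner x (op_app T x)) = 0"
    by (metis add.inverse_inverse cnj.sel(2) equal_neg_zero)
  then have "Im (cinner x u) = 0"
    by (simp add: u_def cinner_diff_right cinner_scaleR_right cinner_self flip: of_real_mult)
  then have "Im (cinner u x) = 0"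
    by (subst cinner_commute) simp
  then have "Re (cinner u (c *\<^sub>C x)) = 0"
    by (simp add: c_def cinner_scaleC_right)
  moreover have "norm (c *\<^sub>C x) = \<bar>Im z\<bar> * norm x"
    by (simp add: norm_scaleC c_def norm_mult)
  moreover have "op_app T x - z *\<^sub>C x = u + c *\<^sub>C x"
  proof -
    have "z *\<^sub>C x = of_real (Re z) *\<^sub>C x - c *\<^sub>C x"
      using complex_eq[of z] by (simp add: c_def mult.commute flip: scaleC_diff_left)
    then show ?thesis by (simp add: u_def scaleC_of_real)
  qed
  ultimately show ?thesis
    using norm_add_square[of u "c *\<^sub>C x"] by (simp only: u_def)
qed

lemma norm_op_shift_ge:
  fixes T :: "'h::complex_inner partial_op"
  assumes "symmetric_op T" "x \<in> op_dom T"
  shows "\<bar>Im z\<bar> * norm x \<le> norm (op_app T x - z *\<^sub>C x)"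
  by (rule power2_le_imp_le) (simp_all add: norm_op_shift_square[OF assms, of z])

lemma Im_nonzero: "z \<notin> \<real> \<Longrightarrow> \<bar>Im z\<bar> > 0"
  by (simp add: complex_is_Real_iff)

text \<open>The range of \<open>T - z\<close> is closed by the lower bound on \<open>T - z\<close> and because a self-adjoint
  operator is closed.  A vector orthogonal to it lies in the domain of the adjoint, that is in the
  domain of \<open>T\<close>, and is an eigenvector of \<open>T\<close> with nonreal eigenvalue, hence zero.\<close>

theorem self_adjoint_shift_surj:
  fixes K :: "'h::complex_hilbert set"
  assumes T: "self_adjoint_on K T" and K: "closed K" "csubspace K" and z: "z \<notin> \<real>" and "y \<in> K"
  obtains x where "x \<in> op_dom T" "op_app T x - z *\<^sub>C x = y"
proof -
  have lin0: "linear_operator_on K T" using T by (simp add: self_adjoint_on_def)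
  note lin = linear_operator_onD[OF lin0]
  note sym = self_adjoint_symmetric[OF T K(2)]
  define f where "f x = op_app T x - z *\<^sub>C x" for x
  define V where "V = f ` op_dom T"
  have f_diff: "f x - f y = f (x - y)" if "x \<in> op_dom T" "y \<in> op_dom T" for x y
    using shifted_op_diff[OF lin0 that, of z] by (simp only: f_def)
  have VK: "V \<subseteq> K"
    using lin(2,3) K(2) by (auto simp: V_def f_def csubspace_def intro!: csubspace_diff[OF K(2)])
  have "csubspace V"
    unfolding csubspace_def
  proof (intro conjI ballI allI)
    have "f 0 = 0" "0 \<in> op_dom T"
      using f_diff[of 0 0] lin(1) by (auto simp: csubspace_def)
    then show "0 \<in> V" by (force simp: V_def)
  next
    fix u v assume "u \<in> V" "v \<in> V"
    then obtain x y where "x \<in> op_dom T" "y \<in> op_dom T" "u = f x" "v = f y"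
      by (auto simp: V_def)
    then have "x + y \<in> op_dom T" "u + v = f (x + y)"
      using lin(1,4) by (auto simp: csubspace_def f_def scaleC_add_right)
    then show "u + v \<in> V" by (simp add: V_def)
  next
    fix c u assume "u \<in> V"
    then obtain x where "x \<in> op_dom T" "u = f x"
      by (auto simp: V_def)
    then have "c *\<^sub>C x \<in> op_dom T" "c *\<^sub>C u = f (c *\<^sub>C x)"
      using lin(1,5) by (auto simp: csubspace_def f_def scaleC_diff_right scaleC_scaleC mult.commute)
    then show "c *\<^sub>C u \<in> V" by (simp add: V_def)
  qed
  moreover have "closed V"
    unfolding closed_sequential_limits
  proof (intro allI impI, elim conjE)
    fix s y assume "\<forall>n. s n \<in> V" and s: "s \<longlonglongrightarrow> y"
    then have "\<forall>n. \<exists>x. x \<in> op_dom T \<and> s n = f x" by (auto simp: V_def)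
    then obtain t where t: "\<And>n. t n \<in> op_dom T" and ft: "s = (\<lambda>n. f (t n))"
      by metis
    have bound: "\<bar>Im z\<bar> * norm (t m - t n) \<le> norm (s m - s n)" for m n
      using norm_op_shift_ge[OF sym csubspace_diff[OF lin(1) t t], of z m n] f_diff[OF t t, of m n]
      by (simp add: ft f_def)
    have "Cauchy t"
    proof (rule metric_CauchyI)
      fix e :: real assume "0 < e"
      then obtain M where M: "\<And>m n. m \<ge> M \<Longrightarrow> n \<ge> M \<Longrightarrow> dist (s m) (s n) < \<bar>Im z\<bar> * e"
        using metric_CauchyD[OF LIMSEQ_imp_Cauchy[OF s], of "\<bar>Im z\<bar> * e"] Im_nonzero[OF z] by auto
      show "\<exists>M. \<forall>m\<ge>M. \<forall>n\<ge>M. dist (t m) (t n) < e"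
      proof (intro exI allI impI)
        fix m n assume "M \<le> m" "M \<le> n"
        then have "\<bar>Im z\<bar> * norm (t m - t n) < \<bar>Im z\<bar> * e"
          using M[of m n] bound[of m n] by (simp add: dist_norm)
        then show "dist (t m) (t n) < e"
          using Im_nonzero[OF z] by (simp add: dist_norm)
      qed
    qed
    then obtain x where x: "t \<longlonglongrightarrow> x"
      using Cauchy_convergent_iff convergent_def by blast
    have xK: "x \<in> K"
      by (rule closed_sequentially[OF K(1) _ x]) (use t lin(2) in blast)
    have yK: "y \<in> K"
      by (rule closed_sequentially[OF K(1) _ s]) (use \<open>\<forall>n. s n \<in> V\<close> VK in blast)
    have "x \<in> op_dom T \<and> op_app T x = y + z *\<^sub>C x"
    proof (rule self_adjoint_maximal[OF T K(2) xK])
      show "y + z *\<^sub>C x \<in> K" using K(2) xK yK by (simp add: csubspace_def)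
      fix u assume u: "u \<in> op_dom T"
      have "cinner (t n) (op_app T u) = cinner (s n + z *\<^sub>C t n) u" for n
        using sym t u by (simp add: symmetric_op_def ft f_def)
      moreover have "(\<lambda>n. cinner (t n) (op_app T u)) \<longlonglongrightarrow> cinner x (op_app T u)"
        by (rule tendsto_cinner_left[OF x])
      moreover have "(\<lambda>n. cinner (s n + z *\<^sub>C t n) u) \<longlonglongrightarrow> cinner (y + z *\<^sub>C x) u"
        by (intro tendsto_cinner_left tendsto_add tendsto_scaleC s x)
      ultimately show "cinner x (op_app T u) = cinner (y + z *\<^sub>C x) u"
        using LIMSEQ_unique by simp
    qed
    then show "y \<in> V" by (auto simp: V_def f_def image_iff intro!: bexI[of _ x])
  qed
  moreover have "w = 0" if w: "w \<in> K" and orth: "\<And>v. v \<in> V \<Longrightarrow> cinner w v = 0" for w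
  proof -
    have "w \<in> op_dom T \<and> op_app T w = cnj z *\<^sub>C w"
    proof (rule self_adjoint_maximal[OF T K(2) w])
      show "cnj z *\<^sub>C w \<in> K" using w K(2) by (simp add: csubspace_def)
      fix x assume "x \<in> op_dom T"
      then have "cinner w (f x) = 0" using orth by (simp add: V_def)
      then show "cinner w (op_app T x) = cinner (cnj z *\<^sub>C w) x"
        by (simp add: f_def cinner_diff_right cinner_scaleC_right cinner_scaleC_left)
    qed
    then show "w = 0"
      using norm_op_shift_ge[OF sym, of w "cnj z"] Im_nonzero[OF z] by (auto simp: mult_le_0_iff)
  qed
  ultimately have "V = K"
    using closed_subspace_eqI[of V K] VK K(2) by blast
  with \<open>y \<in> K\<close> show ?thesis
    using that by (auto simp: V_def f_def)
qed

text \<open>If \<open>y\<close> is in the domain of the adjoint, with value \<open>w\<close>, solve \<open>(T - i\<mu>) x = w - i\<mu> y\<close>.  Then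
  \<open>y - x\<close> is orthogonal to the range of \<open>T + i\<mu>\<close>, which is everything, so \<open>y = x\<close>.\<close>

lemma self_adjoint_onI_surj:
  fixes K :: "'h::complex_inner set"
  assumes K: "csubspace K" and T: "linear_operator_on K T" "densely_defined_on K T" "symmetric_op T"
    and surj: "\<And>z y. \<lbrakk>z = \<i> * of_real \<mu> \<or> z = - (\<i> * of_real \<mu>); y \<in> K\<rbrakk>
      \<Longrightarrow> \<exists>x\<in>op_dom T. op_app T x - z *\<^sub>C x = y"
  shows "self_adjoint_on K T"
proof (rule self_adjoint_onI[OF K T])
  fix y w assume y: "y \<in> K" and w: "w \<in> K"
    and yw: "\<And>x. x \<in> op_dom T \<Longrightarrow> cinner y (op_app T x) = cinner w x"
  define z where "z = \<i> * of_real \<mu>"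
  have cz: "cnj z = - (\<i> * of_real \<mu>)" by (simp add: z_def)
  have "w - z *\<^sub>C y \<in> K"
    using K y w by (intro csubspace_diff[OF K]) (auto simp: csubspace_def)
  then obtain x where x: "x \<in> op_dom T" "op_app T x - z *\<^sub>C x = w - z *\<^sub>C y"
    using surj[of z] by (auto simp: z_def)
  have "y - x \<in> K"
    using csubspace_diff[OF K y] x(1) linear_operator_onD(2)[OF T(1)] by blast
  then obtain u where u: "u \<in> op_dom T" "op_app T u - cnj z *\<^sub>C u = y - x"
    using surj[of "cnj z"] cz by blast
  have "cinner (y - x) (y - x) = cinner (y - x) (op_app T u - cnj z *\<^sub>C u)"
    by (simp only: u)
  also have "\<dots> = cinner w u - cinner (op_app T x) u - cinner (z *\<^sub>C y - z *\<^sub>C x) u"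
    using yw[OF u(1)] T(3) x(1) u(1)
    by (simp add: symmetric_op_def cinner_diff_left cinner_diff_right cinner_scaleC_left
        cinner_scaleC_right algebra_simps)
  also have "\<dots> = cinner ((w - z *\<^sub>C y) - (op_app T x - z *\<^sub>C x)) u"
    by (simp add: cinner_diff_left)
  also have "\<dots> = 0" by (simp add: x(2))
  finally show "y \<in> op_dom T" using x(1) by (simp add: cinner_self_eq_0)
qed

section \<open>Relatively bounded perturbations\<close>

lemma linear_operator_op_plus:
  assumes "linear_operator_on UNIV S" "linear_operator_on UNIV T"
  shows "linear_operator_on UNIV (op_plus S (T::'h::complex_inner partial_op))"
  using assms
  by (auto simp: linear_operator_on_def op_plus_def csubspace_def scaleC_add_right algebra_simps)

lemma symmetric_op_plus:
  assumes "symmetric_op S" "symmetric_op T"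
  shows "symmetric_op (op_plus S (T::'h::complex_inner partial_op))"
  using assms by (simp add: symmetric_op_def op_plus_def cinner_add_left cinner_add_right)

text \<open>The Kato--Rellich theorem.  For large \<open>\<bar>\<mu>\<bar>\<close> the operator \<open>S (T - i\<mu>)\<^sup>-\<^sup>1\<close> is a strict
  contraction, because \<open>\<parallel>(T - i\<mu>) x\<parallel>\<^sup>2 = \<parallel>T x\<parallel>\<^sup>2 + \<mu>\<^sup>2 \<parallel>x\<parallel>\<^sup>2\<close>.  Hence \<open>1 + S (T - i\<mu>)\<^sup>-\<^sup>1\<close> is
  surjective by Banach's fixed point theorem, and so is \<open>T + S - i\<mu>\<close>.\<close>

theorem Kato_Rellich:
  fixes S T :: "'h::complex_hilbert partial_op"
  assumes T: "self_adjoint_on UNIV T" and S: "linear_operator_on UNIV S" "symmetric_op S"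
    and dom: "op_dom T \<subseteq> op_dom S" and "0 \<le> a" "a < 1" "0 \<le> b"
    and bound: "\<And>x. x \<in> op_dom T \<Longrightarrow> norm (op_app S x) \<le> a * norm (op_app T x) + b * norm x"
  shows "self_adjoint_on UNIV (op_plus T S)"
proof -
  have linT: "linear_operator_on UNIV T" and dense: "densely_defined_on UNIV T"
    using T by (auto simp: self_adjoint_on_def)
  note symT = self_adjoint_symmetric[OF T csubspace_UNIV]
  (* The contraction constant will be a + b / mu; mu is chosen so that it is at most the midpoint q
     between a and 1.  The summand 1 keeps it positive if b = 0. *)
  define \<mu> where "\<mu> = 2 * (b + 1) / (1 - a)"
  define q where "q = (1 + a) / 2"
  have \<mu>: "0 < \<mu>" "b / \<mu> \<le> (1 - a) / 2" and q: "0 \<le> q" "q < 1"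
    using assms(5-7) by (auto simp: \<mu>_def q_def field_simps)
  have surj: "\<exists>x\<in>op_dom T. op_app T x + op_app S x - z *\<^sub>C x = y"
    if z: "z = \<i> * of_real \<mu> \<or> z = - (\<i> * of_real \<mu>)" for z y
  proof -
    have [simp]: "Re z = 0" "\<bar>Im z\<bar> = \<mu>" and "z \<notin> \<real>"
      using z \<mu>(1) by (auto simp: complex_is_Real_iff)
    then have "\<forall>v. \<exists>x. x \<in> op_dom T \<and> op_app T x - z *\<^sub>C x = v"
      using self_adjoint_shift_surj[OF T closed_UNIV csubspace_UNIV] by (metis UNIV_I)
    then obtain R where R: "\<And>v. R v \<in> op_dom T" "\<And>v. op_app T (R v) - z *\<^sub>C R v = v"
      by metis
    have contr: "norm (op_app S (R u) - op_app S (R v)) \<le> q * norm (u - v)" for u v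
    proof -
      define x where "x = R u - R v"
      have x: "x \<in> op_dom T"
        using R(1) csubspace_diff[OF linear_operator_onD(1)[OF linT]] by (simp add: x_def)
      have Tx: "op_app T x - z *\<^sub>C x = u - v"
        by (simp only: x_def shifted_op_diff[OF linT R(1) R(1)] R(2))
      have sq: "(norm (u - v))\<^sup>2 = (norm (op_app T x))\<^sup>2 + (\<mu> * norm x)\<^sup>2"
        using norm_op_shift_square[OF symT x, of z] by (simp add: Tx)
      have 1: "norm (op_app T x) \<le> norm (u - v)"
        by (rule power2_le_imp_le) (simp_all add: sq)
      have "\<mu> * norm x \<le> norm (u - v)"
        by (rule power2_le_imp_le) (simp_all add: sq)
      then have 2: "norm x \<le> norm (u - v) / \<mu>"
        using \<mu>(1) by (simp add: field_simps)
      have "norm (op_app S x) \<le> a * norm (op_app T x) + b * norm x"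
        by (rule bound[OF x])
      also have "\<dots> \<le> a * norm (u - v) + b * (norm (u - v) / \<mu>)"
        using 1 2 assms(5,7) by (intro add_mono mult_left_mono)
      also have "\<dots> = (a + b / \<mu>) * norm (u - v)"
        by (simp add: algebra_simps)
      also have "\<dots> \<le> q * norm (u - v)"
        using \<mu>(2) by (intro mult_right_mono) (simp_all add: q_def field_simps)
      finally show ?thesis
        using linear_operator_onD(7)[OF S(1), of "R u" "R v"] R(1) dom by (simp add: x_def subset_iff)
    qed
    have "\<exists>!v\<in>UNIV. y - op_app S (R v) = v"
    proof (rule Banach_fix[where c = q])
      show "dist (y - op_app S (R u)) (y - op_app S (R v)) \<le> q * dist u v" for u v
        using contr[of v u] by (simp add: dist_norm norm_minus_commute)
    qed (use q in \<open>auto simp: complete_UNIV\<close>)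
    then obtain v where v: "y - op_app S (R v) = v" by blast
    have "op_app T (R v) + op_app S (R v) - z *\<^sub>C R v
      = (op_app T (R v) - z *\<^sub>C R v) + op_app S (R v)" by simp
    also have "\<dots> = y" using R(2)[of v] v by (metis diff_add_cancel)
    finally show ?thesis using R(1) by blast
  qed
  show ?thesis
  proof (rule self_adjoint_onI_surj[where \<mu> = \<mu>])
    show "densely_defined_on UNIV (op_plus T S)"
      using dense dom by (simp add: densely_defined_on_def op_plus_def Int_absorb2)
    show "\<exists>x\<in>op_dom (op_plus T S). op_app (op_plus T S) x - z *\<^sub>C x = y"
      if "z = \<i> * of_real \<mu> \<or> z = - (\<i> * of_real \<mu>)" for z y
      using surj[OF that, of y] dom by (auto simp: op_plus_def)
  qed (use linT S symT in \<open>auto intro: linear_operator_op_plus symmetric_op_plus csubspace_UNIV\<close>)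
qed

lemma op_plus_commute: "op_plus S T = op_plus T (S::'h::complex_inner partial_op)"
  by (simp add: op_plus_def Int_commute add.commute)

lemma self_adjoint_op_scale:
  fixes T :: "'h::complex_inner partial_op"
  assumes T: "self_adjoint_on UNIV T" and "\<beta> \<noteq> 0"
  shows "self_adjoint_on UNIV (op_scale (of_real \<beta>) T)"
proof (rule self_adjoint_onI[OF csubspace_UNIV])
  show "linear_operator_on UNIV (op_scale (of_real \<beta>) T)"
    using T by (auto simp: self_adjoint_on_def linear_operator_on_def op_scale_def
        scaleC_add_right scaleC_scaleC mult.commute)
  show "densely_defined_on UNIV (op_scale (of_real \<beta>) T)"
    using T by (simp add: self_adjoint_on_def densely_defined_on_def op_scale_def)
  show "symmetric_op (op_scale (of_real \<beta>) T)"
    using self_adjoint_symmetric[OF T csubspace_UNIV]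
    by (simp add: symmetric_op_def op_scale_def cinner_scaleC_left cinner_scaleC_right)
  fix y w
  assume yw: "\<And>x. x \<in> op_dom (op_scale (of_real \<beta>) T) \<Longrightarrow>
    cinner y (op_app (op_scale (of_real \<beta>) T) x) = cinner w x"
  have "y \<in> op_dom T \<and> op_app T y = of_real (1 / \<beta>) *\<^sub>C w"
  proof (rule self_adjoint_maximal[OF T csubspace_UNIV])
    fix x assume "x \<in> op_dom T"
    from yw[of x] this have "of_real \<beta> * cinner y (op_app T x) = cinner w x"
      by (simp add: op_scale_def cinner_scaleC_right)
    then show "cinner y (op_app T x) = cinner (of_real (1 / \<beta>) *\<^sub>C w) x"
      using \<open>\<beta> \<noteq> 0\<close> by (simp add: cinner_scaleC_left field_simps)
  qed simp_all
  then show "y \<in> op_dom (op_scale (of_real \<beta>) T)" by (simp add: op_scale_def)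
qed

section \<open>Resolvents, kernels and bounded self-adjoint operators\<close>

lemma op_app_op_inverse:
  assumes "inj_on (op_app T) (op_dom T)" "x \<in> op_dom T"
  shows "op_app (op_inverse T) (op_app T x) = x"
  using assms unfolding op_inverse_def partial_op.sel by (intro the_equality) (auto dest: inj_onD)

lemma resolvent_solves:
  fixes K :: "'h::complex_hilbert set"
  assumes T: "self_adjoint_on K T" and K: "closed K" "csubspace K" and z: "z \<notin> \<real>" and "y \<in> K"
  defines "x \<equiv> op_app (resolvent T z) y"
  shows "x \<in> op_dom T" and "op_app T x - z *\<^sub>C x = y"
proof -
  have lin: "linear_operator_on K T" using T by (simp add: self_adjoint_on_def)
  obtain v where v: "v \<in> op_dom T" "op_app T v - z *\<^sub>C v = y"
    using self_adjoint_shift_surj[OF assms(1-5)] by blast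
  have "inj_on (op_app (op_shift T z)) (op_dom (op_shift T z))"
  proof (rule inj_onI)
    fix a b
    assume ab: "a \<in> op_dom (op_shift T z)" "b \<in> op_dom (op_shift T z)"
      and eq: "op_app (op_shift T z) a = op_app (op_shift T z) b"
    then have d: "a - b \<in> op_dom T"
      using csubspace_diff[OF linear_operator_onD(1)[OF lin]] by (simp add: op_shift_def)
    have "op_app T (a - b) - z *\<^sub>C (a - b) = 0"
      using eq ab shifted_op_diff[OF lin, of a b z] by (simp add: op_shift_def)
    then have "\<bar>Im z\<bar> * norm (a - b) \<le> 0"
      using norm_op_shift_ge[OF self_adjoint_symmetric[OF T K(2)] d, of z] by simp
    then show "a = b"
      using Im_nonzero[OF z] by (simp add: mult_le_0_iff)
  qed
  from op_app_op_inverse[OF this, of v] have "x = v"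
    using v by (simp add: x_def resolvent_def op_shift_def)
  with v show "x \<in> op_dom T" "op_app T x - z *\<^sub>C x = y" by simp_all
qed

text \<open>The lower bound on \<open>T - z\<close>, applied to the error of an approximate solution.  The constant
  depends on \<open>z\<close> alone, so the estimate is uniform over a family of operators \<open>T\<close>.\<close>

lemma resolvent_residual_estimate:
  fixes T :: "'h::complex_hilbert partial_op"
  assumes T: "self_adjoint_on UNIV T" and z: "z \<notin> \<real>" and v: "v \<in> op_dom T"
  shows "norm (op_app (resolvent T z) \<psi> - v) \<le> norm (\<psi> - (op_app T v - z *\<^sub>C v)) / \<bar>Im z\<bar>"
proof -
  have lin: "linear_operator_on UNIV T" using T by (simp add: self_adjoint_on_def)
  define x where "x = op_app (resolvent T z) \<psi>"
  have x: "x \<in> op_dom T" "op_app T x - z *\<^sub>C x = \<psi>"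
    using resolvent_solves[OF T closed_UNIV csubspace_UNIV z UNIV_I, of \<psi>] by (simp_all add: x_def)
  have "op_app T (x - v) - z *\<^sub>C (x - v) = \<psi> - (op_app T v - z *\<^sub>C v)"
    using shifted_op_diff[OF lin x(1) v, of z] by (simp only: x(2))
  then have "\<bar>Im z\<bar> * norm (x - v) \<le> norm (\<psi> - (op_app T v - z *\<^sub>C v))"
    using norm_op_shift_ge[OF self_adjoint_symmetric[OF T csubspace_UNIV], of "x - v" z]
      csubspace_diff[OF linear_operator_onD(1)[OF lin] x(1) v] by simp
  then show ?thesis
    using Im_nonzero[OF z] by (simp add: x_def field_simps)
qed

lemma
  fixes T :: "'h::complex_inner partial_op"
  assumes T: "self_adjoint_on UNIV T"
  shows closed_op_kernel: "closed (op_kernel T)"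
    and csubspace_op_kernel: "csubspace (op_kernel T)"
    and in_op_kernelI: "(\<And>x. x \<in> op_dom T \<Longrightarrow> cinner w (op_app T x) = 0) \<Longrightarrow> w \<in> op_kernel T"
proof -
  have lin: "linear_operator_on UNIV T" using T by (simp add: self_adjoint_on_def)
  note lin = linear_operator_onD[OF lin]
  note sym = self_adjoint_symmetric[OF T csubspace_UNIV]
  have I: "w \<in> op_kernel T" if "\<And>x. x \<in> op_dom T \<Longrightarrow> cinner w (op_app T x) = 0" for w
    using self_adjoint_maximal[OF T csubspace_UNIV, of w 0] that by (simp add: op_kernel_def)
  then show "(\<And>x. x \<in> op_dom T \<Longrightarrow> cinner w (op_app T x) = 0) \<Longrightarrow> w \<in> op_kernel T" .
  show "csubspace (op_kernel T)"
    using lin(1,4) lin(5)[of 0 0] lin(5) unfolding csubspace_def op_kernel_def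
    using lin(7)[of 0 0] by auto
  show "closed (op_kernel T)"
    unfolding closed_sequential_limits
  proof (intro allI impI, elim conjE)
    fix s l assume s: "\<forall>n. s n \<in> op_kernel T" and l: "s \<longlonglongrightarrow> l"
    show "l \<in> op_kernel T"
    proof (rule I)
      fix x assume x: "x \<in> op_dom T"
      have "cinner (s n) (op_app T x) = 0" for n
        using s sym x by (simp add: symmetric_op_def op_kernel_def)
      moreover have "(\<lambda>n. cinner (s n) (op_app T x)) \<longlonglongrightarrow> cinner l (op_app T x)"
        by (rule tendsto_cinner_left[OF l])
      ultimately show "cinner l (op_app T x) = 0"
        by (simp add: LIMSEQ_const_iff)
    qed
  qed
qed

text \<open>The component of \<open>g\<close> orthogonal to the images of \<open>D\<close> lies in the kernel, so it is also
  orthogonal to \<open>g\<close>, and hence zero.  A subspace \<open>D\<close> of the domain is allowed because the vectors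
  approximating \<open>g\<close> have to lie in the domain of a second operator too.\<close>

lemma orthogonal_op_kernel_imp_closure_image:
  fixes T :: "'h::complex_hilbert partial_op"
  assumes T: "linear_operator_on UNIV T" and D: "csubspace D" "D \<subseteq> op_dom T"
    and core: "\<And>w. (\<And>x. x \<in> D \<Longrightarrow> cinner w (op_app T x) = 0) \<Longrightarrow> w \<in> op_kernel T"
    and g: "\<And>w. w \<in> op_kernel T \<Longrightarrow> cinner w g = 0"
  shows "g \<in> closure (op_app T ` D)"
proof -
  have "csubspace (op_app T ` D)"
    unfolding csubspace_def
  proof (intro conjI ballI allI)
    have "0 \<in> D" using D(1) by (simp add: csubspace_def)
    moreover have "op_app T 0 = 0"
      using linear_operator_onD(7)[OF T, of 0 0] \<open>0 \<in> D\<close> D(2) by auto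
    ultimately show "0 \<in> op_app T ` D" by force
  next
    fix u v assume "u \<in> op_app T ` D" "v \<in> op_app T ` D"
    then obtain x y where xy: "x \<in> D" "y \<in> D" "u = op_app T x" "v = op_app T y" by blast
    then have "x + y \<in> D" "u + v = op_app T (x + y)"
      using D linear_operator_onD(4)[OF T] by (auto simp: csubspace_def subset_iff)
    then show "u + v \<in> op_app T ` D" by blast
  next
    fix c u assume "u \<in> op_app T ` D"
    then obtain x where "x \<in> D" "u = op_app T x" by blast
    then have "c *\<^sub>C x \<in> D" "c *\<^sub>C u = op_app T (c *\<^sub>C x)"
      using D linear_operator_onD(5)[OF T] by (auto simp: csubspace_def subset_iff)
    then show "c *\<^sub>C u \<in> op_app T ` D" by blast
  qed
  from csubspace_closure[OF this]
  obtain y where y: "y \<in> closure (op_app T ` D)"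
    "\<And>v. v \<in> closure (op_app T ` D) \<Longrightarrow> cinner v (g - y) = 0"
    by (rule orthogonal_projection_exists[OF closed_closure, where x = g]) blast
  have "g - y \<in> op_kernel T"
  proof (rule core)
    fix x assume "x \<in> D"
    then have "op_app T x \<in> closure (op_app T ` D)" by (simp add: subsetD[OF closure_subset])
    then show "cinner (g - y) (op_app T x) = 0"
      using y(2) by (subst cinner_commute) simp
  qed
  then have "cinner (g - y) g = 0" by (rule g)
  moreover have "cinner (g - y) y = 0"
    using y by (subst cinner_commute) simp
  ultimately have "cinner (g - y) (g - y) = 0"
    by (simp add: cinner_diff_right[of "g - y" g y])
  with y(1) show ?thesis by (simp add: cinner_self_eq_0)
qed

text \<open>If \<open>s n\<close> in the domain converges to \<open>x\<close>, boundedness makes \<open>T (s n)\<close> converge as well, and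
  then \<open>x\<close> is in the domain because a self-adjoint operator is closed.  The domain is dense, so this
  reaches every vector.\<close>

lemma bounded_self_adjoint_everywhere_defined:
  fixes T :: "'h::complex_hilbert partial_op"
  assumes T: "self_adjoint_on UNIV T" and "bounded_op T"
  shows "op_dom T = UNIV"
proof -
  have lin: "linear_operator_on UNIV T" and dense: "closure (op_dom T) = UNIV"
    using T by (auto simp: self_adjoint_on_def densely_defined_on_def)
  obtain M where M: "\<And>x. x \<in> op_dom T \<Longrightarrow> norm (op_app T x) \<le> M * norm x"
    using assms(2) by (auto simp: bounded_op_def)
  have "x \<in> op_dom T" for x
  proof -
    have "x \<in> closure (op_dom T)" by (simp add: dense)
    then obtain s where s: "\<And>n. s n \<in> op_dom T" "s \<longlonglongrightarrow> x"
      unfolding closure_sequential by blast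
    have "Cauchy (\<lambda>n. op_app T (s n))"
    proof (rule metric_CauchyI)
      fix e :: real assume "0 < e"
      then obtain N where N: "\<And>m n. m \<ge> N \<Longrightarrow> n \<ge> N \<Longrightarrow> dist (s m) (s n) < e / (\<bar>M\<bar> + 1)"
        using metric_CauchyD[OF LIMSEQ_imp_Cauchy[OF s(2)], of "e / (\<bar>M\<bar> + 1)"] by auto
      show "\<exists>N. \<forall>m\<ge>N. \<forall>n\<ge>N. dist (op_app T (s m)) (op_app T (s n)) < e"
      proof (intro exI allI impI)
        fix m n assume "N \<le> m" "N \<le> n"
        have "dist (op_app T (s m)) (op_app T (s n)) = norm (op_app T (s m - s n))"
          using linear_operator_onD(7)[OF lin s(1) s(1)] by (simp add: dist_norm)
        also have "\<dots> \<le> M * norm (s m - s n)"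
          using csubspace_diff[OF linear_operator_onD(1)[OF lin] s(1) s(1)] by (rule M)
        also have "\<dots> \<le> (\<bar>M\<bar> + 1) * norm (s m - s n)"
          by (intro mult_right_mono) auto
        also have "\<dots> < e"
          using N[OF \<open>N \<le> m\<close> \<open>N \<le> n\<close>] by (simp add: dist_norm field_simps)
        finally show "dist (op_app T (s m)) (op_app T (s n)) < e" .
      qed
    qed
    then obtain y where y: "(\<lambda>n. op_app T (s n)) \<longlonglongrightarrow> y"
      using Cauchy_convergent_iff convergent_def by blast
    have "x \<in> op_dom T \<and> op_app T x = y"
    proof (rule self_adjoint_maximal[OF T csubspace_UNIV])
      fix u assume u: "u \<in> op_dom T"
      have "cinner (s n) (op_app T u) = cinner (op_app T (s n)) u" for n
        using self_adjoint_symmetric[OF T csubspace_UNIV] s(1) u by (simp add: symmetric_op_def)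
      then show "cinner x (op_app T u) = cinner y u"
        using LIMSEQ_unique[OF tendsto_cinner_left[OF s(2)]] tendsto_cinner_left[OF y] by simp
    qed simp_all
    then show ?thesis by simp
  qed
  then show ?thesis by blast
qed

section \<open>Strong coupling\<close>

text \<open>If \<open>B\<close> is bounded, then \<open>\<beta> B\<close> is a perturbation of \<open>A\<close> with relative bound \<open>0\<close>.  Otherwise
  the roles are exchanged: \<open>A\<close> perturbs \<open>\<beta> B\<close> with relative bound \<open>a / \<beta>\<close>, which is below \<open>1\<close> as
  soon as \<open>\<beta> > a\<close>.\<close>

lemma self_adjoint_coupling:
  fixes A B :: "'h::complex_hilbert partial_op"
  assumes A: "self_adjoint_on UNIV A" and B: "self_adjoint_on UNIV B"
    and "bounded_op B \<or> relatively_bounded A B"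
  shows "\<forall>\<^sub>F \<beta> in at_top. self_adjoint_on UNIV (op_plus A (op_scale (complex_of_real \<beta>) B))"
  using assms(3)
proof
  assume bdd: "bounded_op B"
  then obtain M where M: "\<And>x. x \<in> op_dom B \<Longrightarrow> norm (op_app B x) \<le> M * norm x"
    by (auto simp: bounded_op_def)
  have dom: "op_dom B = UNIV"
    by (rule bounded_self_adjoint_everywhere_defined[OF B bdd])
  have "self_adjoint_on UNIV (op_plus A (op_scale (complex_of_real \<beta>) B))" if "0 < \<beta>" for \<beta>
  proof (rule Kato_Rellich[where a = 0 and b = "\<beta> * \<bar>M\<bar>"])
    have sa: "self_adjoint_on UNIV (op_scale (complex_of_real \<beta>) B)"
      using self_adjoint_op_scale[OF B] that by simp
    then show "linear_operator_on UNIV (op_scale (complex_of_real \<beta>) B)"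
      by (simp add: self_adjoint_on_def)
    show "symmetric_op (op_scale (complex_of_real \<beta>) B)"
      by (rule self_adjoint_symmetric[OF sa csubspace_UNIV])
    fix x
    have "norm (op_app B x) \<le> \<bar>M\<bar> * norm x"
      using M[of x] dom mult_right_mono[OF abs_ge_self, of "norm x" M] by simp
    then show "norm (op_app (op_scale (complex_of_real \<beta>) B) x)
        \<le> 0 * norm (op_app A x) + \<beta> * \<bar>M\<bar> * norm x"
      using that by (simp add: op_scale_def norm_scaleC)
  qed (use A that in \<open>simp_all add: op_scale_def dom\<close>)
  then show ?thesis
    using eventually_gt_at_top by (rule eventually_mono[rotated])
next
  assume "relatively_bounded A B"
  then obtain a b where dom: "op_dom B \<subseteq> op_dom A" and ab: "0 \<le> a" "0 \<le> b"
    and bound: "\<And>x. x \<in> op_dom B \<Longrightarrow> norm (op_app A x) \<le> a * norm (op_app B x) + b * norm x"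
    by (auto simp: relatively_bounded_def)
  have "self_adjoint_on UNIV (op_plus (op_scale (complex_of_real \<beta>) B) A)" if "a < \<beta>" for \<beta>
  proof (rule Kato_Rellich[where a = "a / \<beta>" and b = b])
    show "self_adjoint_on UNIV (op_scale (complex_of_real \<beta>) B)"
      using self_adjoint_op_scale[OF B] that ab by simp
    show "linear_operator_on UNIV A" using A by (simp add: self_adjoint_on_def)
    show "symmetric_op A" by (rule self_adjoint_symmetric[OF A csubspace_UNIV])
    fix x assume "x \<in> op_dom (op_scale (complex_of_real \<beta>) B)"
    then show "norm (op_app A x)
        \<le> a / \<beta> * norm (op_app (op_scale (complex_of_real \<beta>) B) x) + b * norm x"
      using bound[of x] that ab by (simp add: op_scale_def norm_scaleC)
  qed (use dom ab that in \<open>simp_all add: op_scale_def\<close>)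
  then show ?thesis
    using eventually_gt_at_top[of a] by (subst op_plus_commute) (rule eventually_mono[rotated])
qed

text \<open>The intersection of the domains is large enough to see the kernel of \<open>B\<close>: it
  is the domain of \<open>B\<close>, or it is dense and \<open>B\<close> is bounded and symmetric.\<close>

lemma coupling_domain_core:
  fixes A B :: "'h::complex_hilbert partial_op"
  assumes A: "self_adjoint_on UNIV A" and B: "self_adjoint_on UNIV B"
    and "bounded_op B \<or> relatively_bounded A B"
    and orth: "\<And>x. x \<in> op_dom A \<inter> op_dom B \<Longrightarrow> cinner w (op_app B x) = 0"
  shows "w \<in> op_kernel B"
  using assms(3)
proof
  assume "bounded_op B"
  then have dom: "op_dom B = UNIV"
    by (rule bounded_self_adjoint_everywhere_defined[OF B])
  have "cinner (op_app B w) x = 0" if "x \<in> op_dom A" for x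
    using orth[of x] that self_adjoint_symmetric[OF B csubspace_UNIV]
    by (simp add: dom symmetric_op_def)
  moreover have "op_app B w \<in> closure (op_dom A)"
    using A by (auto simp: self_adjoint_on_def densely_defined_on_def)
  ultimately have "cinner (op_app B w) (op_app B w) = 0"
    by (rule orthogonal_to_closure)
  then show ?thesis
    by (simp add: op_kernel_def dom cinner_self_eq_0)
next
  assume "relatively_bounded A B"
  then have "op_dom B \<subseteq> op_dom A" by (simp add: relatively_bounded_def)
  then show ?thesis
    using orth by (intro in_op_kernelI[OF B]) blast
qed

theorem theorem2p1:
  fixes A B :: "'h::complex_hilbert partial_op"
  assumes "self_adjoint_on UNIV A"
    and "self_adjoint_on UNIV B"
    and "bounded_op B \<or> relatively_bounded A B"
    and "self_adjoint_on (op_kernel B) (compression (op_kernel B) A)"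
  shows "\<forall>z \<psi>. z \<notin> \<real> \<longrightarrow>
    ((\<lambda>\<beta>::real.
        norm (op_app (resolvent (op_plus A (op_scale (complex_of_real \<beta>) B)) z) \<psi>
            - op_app (resolvent (compression (op_kernel B) A) z) (ortho_proj (op_kernel B) \<psi>)))
      \<longlongrightarrow> 0) at_top"
proof (intro allI impI)
  fix z :: complex and \<psi> :: 'h
  assume z: "z \<notin> \<real>"
  note A = assms(1) and B = assms(2)
  define K where "K = op_kernel B"
  define P where "P = ortho_proj K"
  define \<phi> where "\<phi> = op_app (resolvent (compression K A) z) (P \<psi>)"
  define R where "R \<beta> = op_app (resolvent (op_plus A (op_scale (complex_of_real \<beta>) B)) z) \<psi>"
    for \<beta>
  define g where "g = \<psi> - (op_app A \<phi> - z *\<^sub>C \<phi>)"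
  have linA: "linear_operator_on UNIV A" and linB: "linear_operator_on UNIV B"
    using A B by (simp_all add: self_adjoint_on_def)
  have K: "closed K" "csubspace K"
    unfolding K_def by (rule closed_op_kernel[OF B], rule csubspace_op_kernel[OF B])
  have "P \<psi> \<in> K" by (simp add: P_def ortho_proj_in[OF K])
  then have \<phi>: "\<phi> \<in> op_dom A" "\<phi> \<in> K" "P (op_app A \<phi>) - z *\<^sub>C \<phi> = P \<psi>"
    using resolvent_solves[OF _ K z, of "compression K A" "P \<psi>"] assms(4)
    by (simp_all add: \<phi>_def compression_def K_def P_def)
  (* So A + beta B agrees with A at phi, and g is the residual of phi for every beta. *)
  have B\<phi>: "\<phi> \<in> op_dom B" "op_app B \<phi> = 0"
    using \<phi>(2) by (auto simp: K_def op_kernel_def)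
  have g: "cinner w g = 0" if "w \<in> K" for w
  proof -
    have "g = (\<psi> - P \<psi>) - (op_app A \<phi> - P (op_app A \<phi>))"
      using \<phi>(3) by (simp add: g_def algebra_simps)
    then show ?thesis
      using ortho_proj_orthogonal[OF K that] by (simp only: cinner_diff_right[of w "_ - _" "_ - _"] P_def diff_self)
  qed
  have D: "csubspace (op_dom A \<inter> op_dom B)"
    using linear_operator_onD(1)[OF linA] linear_operator_onD(1)[OF linB]
    by (auto simp: csubspace_def)
  have "g \<in> closure (op_app B ` (op_dom A \<inter> op_dom B))"
  proof (rule orthogonal_op_kernel_imp_closure_image[OF linB D])
    show "w \<in> op_kernel B"
      if "\<And>x. x \<in> op_dom A \<inter> op_dom B \<Longrightarrow> cinner w (op_app B x) = 0" for w
      using that by (rule coupling_domain_core[OF assms(1-3)])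
  qed (use g in \<open>auto simp: K_def\<close>)
  note approx = this[unfolded closure_approachable]
  have "((\<lambda>\<beta>. norm (R \<beta> - \<phi>)) \<longlongrightarrow> 0) at_top"
  proof (rule tendstoI)
    fix e :: real assume "0 < e"
    then have "0 < e / 2 * \<bar>Im z\<bar>" using Im_nonzero[OF z] by simp
    then obtain \<eta> where \<eta>: "\<eta> \<in> op_dom A" "\<eta> \<in> op_dom B" "norm (g - op_app B \<eta>) < e / 2 * \<bar>Im z\<bar>"
      using approx unfolding dist_norm norm_minus_commute[of _ g] by blast
    define C where "C = norm (op_app A \<eta> - z *\<^sub>C \<eta>) / \<bar>Im z\<bar> + norm \<eta>"
    have "((\<lambda>\<beta>::real. C / \<beta>) \<longlongrightarrow> 0) at_top"
      by (intro tendsto_divide_0[OF tendsto_const] filterlim_at_top_imp_at_infinity filterlim_ident)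
    then have "\<forall>\<^sub>F \<beta> in at_top. C / \<beta> < e / 2"
      by (rule order_tendstoD) (use \<open>0 < e\<close> in simp)
    with self_adjoint_coupling[OF assms(1-3)] eventually_gt_at_top[of 0]
    show "\<forall>\<^sub>F \<beta> in at_top. dist (norm (R \<beta> - \<phi>)) 0 < e"
    proof eventually_elim
      case (elim \<beta>)
      define H where "H = op_plus A (op_scale (complex_of_real \<beta>) B)"
      (* The correction eta / beta lowers the norm of the residual from that of g to nearly that
         of g - B eta; what A adds to it is of order 1 / beta. *)
      define v where "v = \<phi> + (1 / \<beta>) *\<^sub>R \<eta>"
      define r where "r = (1 / \<beta>) *\<^sub>R (op_app A \<eta> - z *\<^sub>C \<eta>)"
      have s\<eta>: "(1 / \<beta>) *\<^sub>R \<eta> \<in> op_dom A" "(1 / \<beta>) *\<^sub>R \<eta> \<in> op_dom B"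
        using \<eta> linear_operator_onD(1)[OF linA] linear_operator_onD(1)[OF linB]
        by (auto intro: csubspace_scaleR)
      have v: "v \<in> op_dom A" "v \<in> op_dom B"
        using s\<eta> \<phi>(1) B\<phi>(1) linear_operator_onD(1)[OF linA] linear_operator_onD(1)[OF linB]
        by (auto simp: v_def csubspace_def)
      have Av: "op_app A v = op_app A \<phi> + (1 / \<beta>) *\<^sub>R op_app A \<eta>"
        unfolding v_def using s\<eta>(1) \<phi>(1) \<eta>(1) linear_operator_onD(4,6)[OF linA] by metis
      have "op_app B v = (1 / \<beta>) *\<^sub>R op_app B \<eta>"
        unfolding v_def using s\<eta>(2) B\<phi> \<eta>(2) linear_operator_onD(4,6)[OF linB] by (metis add_0)
      then have Bv: "complex_of_real \<beta> *\<^sub>C op_app B v = op_app B \<eta>"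
        using elim(2) by (simp add: scaleC_of_real)
      have zv: "z *\<^sub>C v = z *\<^sub>C \<phi> + (1 / \<beta>) *\<^sub>R (z *\<^sub>C \<eta>)"
        by (simp add: v_def scaleC_add_right scaleC_scaleC mult.commute flip: scaleC_of_real)
      have "\<psi> - (op_app H v - z *\<^sub>C v) = (g - op_app B \<eta>) - r"
        by (simp add: H_def op_plus_def op_scale_def Av Bv zv g_def r_def scaleR_diff_right)
      then have "norm (\<psi> - (op_app H v - z *\<^sub>C v)) \<le> norm (g - op_app B \<eta>) + norm r"
        by (metis norm_triangle_ineq4)
      moreover have "norm (R \<beta> - v) \<le> norm (\<psi> - (op_app H v - z *\<^sub>C v)) / \<bar>Im z\<bar>"
        unfolding R_def H_def
        by (rule resolvent_residual_estimate[OF elim(1) z]) (use v in \<open>simp add: op_plus_def op_scale_def\<close>)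
      ultimately have "norm (R \<beta> - v) \<le> (norm (g - op_app B \<eta>) + norm r) / \<bar>Im z\<bar>"
        using Im_nonzero[OF z] by (meson divide_right_mono order_trans less_imp_le)
      moreover have "norm (R \<beta> - \<phi>) \<le> norm (R \<beta> - v) + norm ((1 / \<beta>) *\<^sub>R \<eta>)"
        using norm_triangle_ineq[of "R \<beta> - v" "(1 / \<beta>) *\<^sub>R \<eta>"] by (simp add: v_def)
      moreover have "norm r / \<bar>Im z\<bar> + norm ((1 / \<beta>) *\<^sub>R \<eta>) = C / \<beta>"
        using elim(2) by (simp add: r_def C_def add_divide_distrib mult.commute)
      moreover have "norm (g - op_app B \<eta>) / \<bar>Im z\<bar> < e / 2"
        using \<eta>(3) Im_nonzero[OF z] by (simp add: field_simps)
      ultimately have "norm (R \<beta> - \<phi>) < e"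
        using elim(3) unfolding add_divide_distrib by linarith
      then show ?case by simp
    qed
  qed
  then show "((\<lambda>\<beta>::real.
        norm (op_app (resolvent (op_plus A (op_scale (complex_of_real \<beta>) B)) z) \<psi>
            - op_app (resolvent (compression (op_kernel B) A) z) (ortho_proj (op_kernel B) \<psi>)))
      \<longlongrightarrow> 0) at_top"
    by (simp only: R_def \<phi>_def K_def P_def)
qed

end
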